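(* Let $X$ and $Y$ be topological spaces, let $f : X \to Y$ be a function and let $x\in X$. The following are equivalent: (1) $f$ is weakly $eR$-continuous at $x$; (2) $x \in e\text{-}int_{\theta}(f^{-1}[cl(V)])$ for each neighborhood $V$ of $f(x)$.
   Context: For a subset $A$ of a topological space $X$, $cl(A)$ and $int(A)$ denote closure and interior. The $\delta$-closure $cl_\delta(A)$ is the set of all $x\in X$ such that $int(cl(U))\cap A\neq\emptyset$ for every open set $U$ containing $x$; the $\delta$-interior $int_\delta(A)$ is the set of all $x$ for which there is an open $U$ containing $x$ with $int(cl(U))\subseteq A$. $A$ is $e$-open if $A\subseteq cl(int_\delta(A))\cup int(cl_\delta(A))$; $A$ is $e$-closed if its complement is $e$-open; $A$ is $e$-regular if it is both $e$-open and $e$-closed. The $e$-closure $e\text{-}cl(A)$ is the intersection of all $e$-closed sets containing $A$. The $e$-$\theta$-interior $e\text{-}int_\theta(A)$ is the set of all $x$ for which there is an $e$-open set $U$ containing $x$ with $e\text{-}cl(U)\subseteq A$. A function $f:X\to Y$ is weakly $eR$-continuous at $x\in X$ if for every open set $V$ of $Y$ containing $f(x)$ there exists an $e$-regular set $U$ in $X$ containing $x$ with $f[U]\subseteq cl(V)$. *)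

theory Defs
  imports "HOL-Analysis.Elementary_Topology"
begin

definition delta_closure :: "'a::topological_space set \<Rightarrow> 'a set" where
  "delta_closure A = {x. \<forall>U. open U \<and> x \<in> U \<longrightarrow> interior (closure U) \<inter> A \<noteq> {}}"

definition delta_interior :: "'a::topological_space set \<Rightarrow> 'a set" where
  "delta_interior A = {x. \<exists>U. open U \<and> x \<in> U \<and> interior (closure U) \<subseteq> A}"

definition e_open :: "'a::topological_space set \<Rightarrow> bool" where
  "e_open A \<longleftrightarrow> A \<subseteq> closure (delta_interior A) \<union> interior (delta_closure A)"

definition e_closed :: "'a::topological_space set \<Rightarrow> bool" where
  "e_closed A \<longleftrightarrow> e_open (- A)"

definition e_regular :: "'a::topological_space set \<Rightarrow> bool" where
  "e_regular A \<longleftrightarrow> e_open A \<and> e_closed A"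

definition e_closure :: "'a::topological_space set \<Rightarrow> 'a set" where
  "e_closure A = \<Inter>{F. e_closed F \<and> A \<subseteq> F}"

definition e_theta_interior :: "'a::topological_space set \<Rightarrow> 'a set" where
  "e_theta_interior A = {x. \<exists>U. e_open U \<and> x \<in> U \<and> e_closure U \<subseteq> A}"

definition weakly_eR_continuous_at ::
  "('a::topological_space \<Rightarrow> 'b::topological_space) \<Rightarrow> 'a \<Rightarrow> bool" where
  "weakly_eR_continuous_at f x \<longleftrightarrow>
    (\<forall>V. open V \<and> f x \<in> V \<longrightarrow> (\<exists>U. e_regular U \<and> x \<in> U \<and> f ` U \<subseteq> closure V))"

text \<open>Neighborhoods are not required to be open.\<close>

definition neighborhood :: "'a::topological_space \<Rightarrow> 'a set \<Rightarrow> bool" where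
  "neighborhood y V \<longleftrightarrow> (\<exists>W. open W \<and> y \<in> W \<and> W \<subseteq> V)"

end

theory Submission imports Defs
begin

text \<open>The crux is that the \<open>e\<close>-closure of an \<open>e\<close>-open set is \<open>e\<close>-regular. A set is
  \<open>e\<close>-closed iff it contains the intersection of the interior of its \<open>\<delta>\<close>-closure with the
  closure of its \<open>\<delta>\<close>-interior, and adjoining this intersection to a set changes neither of the
  two. Hence a single such step computes the \<open>e\<close>-closure, and it preserves \<open>e\<close>-openness.\<close>

lemma interior_closure_idem:
  "interior (closure (interior (closure U))) = interior (closure U)"
  by (intro equalityI interior_mono interior_maximal open_interior closure_subset
      closure_minimal closed_closure interior_subset)

lemma open_delta_interior: "open (delta_interior A)"
  unfolding delta_interior_def by (subst open_subopen) blast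

lemma delta_interior_compl: "delta_interior (- A) = - delta_closure A"
  unfolding delta_interior_def delta_closure_def by blast

lemma delta_closure_compl: "delta_closure (- A) = - delta_interior A"
  using delta_interior_compl[of "- A"] by auto

lemma delta_interior_mono: "A \<subseteq> B \<Longrightarrow> delta_interior A \<subseteq> delta_interior B"
  unfolding delta_interior_def by blast

lemma delta_closure_mono: "A \<subseteq> B \<Longrightarrow> delta_closure A \<subseteq> delta_closure B"
  unfolding delta_closure_def by blast

lemma subset_delta_closure: "A \<subseteq> delta_closure A"
  using interior_maximal[OF closure_subset] unfolding delta_closure_def by blast

text \<open>The set \<open>interior (closure U)\<close> is itself an open neighborhood of any point
  \<open>y\<close> it contains, and interior of closure leaves it unchanged. So testing
  \<open>y\<close> against it yields a point of \<open>A\<close> in the same set.\<close>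

lemma delta_closure_idem: "delta_closure (delta_closure A) = delta_closure A"
proof (intro equalityI subset_delta_closure subsetI)
  fix x assume x: "x \<in> delta_closure (delta_closure A)"
  show "x \<in> delta_closure A"
    unfolding delta_closure_def
  proof (intro CollectI allI impI)
    fix U assume "open U \<and> x \<in> U"
    with x obtain y where "y \<in> interior (closure U)" "y \<in> delta_closure A"
      unfolding delta_closure_def by blast
    then show "interior (closure U) \<inter> A \<noteq> {}"
      unfolding delta_closure_def using interior_closure_idem[of U] open_interior by fastforce
  qed
qed

text \<open>Complementation swaps closure with interior, also in the \<delta>-versions, and turns
  the union in \<open>e_open\<close> into an intersection.\<close>

lemma e_closed_iff:
  "e_closed A \<longleftrightarrow> interior (delta_closure A) \<inter> closure (delta_interior A) \<subseteq> A"
  unfolding e_closed_def e_open_def delta_interior_compl delta_closure_compl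
    closure_complement interior_complement by blast

text \<open>If \<open>x\<close> on the left lay outside the closure, deleting that closure from
  \<open>interior (closure U)\<close> would leave an open \<open>W\<close> around \<open>x\<close>
  with \<open>interior (closure W)\<close> inside \<open>A\<close>, which forces \<open>x\<close>
  into \<open>delta_interior A\<close>.\<close>

lemma delta_interior_Un_closure:
  "delta_interior (A \<union> closure (delta_interior A)) \<subseteq> closure (delta_interior A)"
proof (rule ccontr)
  let ?C = "closure (delta_interior A)"
  assume "\<not> ?thesis"
  then obtain x U where x: "x \<notin> ?C" "x \<in> U" "open U"
    and sub: "interior (closure U) \<subseteq> A \<union> ?C"
    unfolding delta_interior_def[of "A \<union> ?C"] by blast
  define W where "W = interior (closure U) - ?C"
  have "open W" by (simp add: W_def open_Diff)
  moreover have "x \<in> W"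
    using x interior_maximal[OF closure_subset] by (auto simp: W_def)
  moreover have "interior (closure W) \<subseteq> A"
  proof -
    have "interior (closure W) \<subseteq> interior (closure (interior (closure U)))"
      by (intro interior_mono closure_mono) (auto simp: W_def)
    \<comment> \<open>Disjointness from an open set passes to closures. This is used twice: first
      for \<open>W\<close> against the open \<open>delta_interior A\<close>, then for
      \<open>delta_interior A\<close> against the open \<open>interior (closure W)\<close>.\<close>
    moreover have "interior (closure W) \<inter> ?C = {}"
    proof -
      have "closure W \<inter> delta_interior A = {}"
        using open_Int_closure_eq_empty[OF open_delta_interior, of A W] closure_subset
        unfolding W_def by blast
      then have "interior (closure W) \<inter> delta_interior A = {}"
        using interior_subset by blast
      then show ?thesis
        by (simp add: open_Int_closure_eq_empty)
    qed
    ultimately show ?thesis using sub interior_closure_idem by blast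
  qed
  ultimately have "x \<in> delta_interior A"
    unfolding delta_interior_def by blast
  with x closure_subset show False by blast
qed

context
  fixes A B :: "'a::topological_space set"
  defines "B \<equiv> A \<union> interior (delta_closure A) \<inter> closure (delta_interior A)"
begin

text \<open>\<open>B\<close> lies between \<open>A\<close> and \<open>delta_closure A\<close>, so
  idempotence applies.\<close>

lemma interior_delta_closure_e_hull:
  "interior (delta_closure B) = interior (delta_closure A)"
proof -
  have "B \<subseteq> delta_closure A"
    using subset_delta_closure interior_subset unfolding B_def by blast
  then have "delta_closure B \<subseteq> delta_closure A"
    using delta_closure_mono delta_closure_idem by blast
  moreover have "delta_closure A \<subseteq> delta_closure B"
    by (intro delta_closure_mono) (auto simp: B_def)
  ultimately show ?thesis by auto
qed

text \<open>\<open>B\<close> lies between \<open>A\<close> and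
  \<open>A \<union> closure (delta_interior A)\<close>, so \<open>delta_interior_Un_closure\<close>
  gives the nontrivial inclusion.\<close>

lemma closure_delta_interior_e_hull:
  "closure (delta_interior B) = closure (delta_interior A)"
proof
  have "delta_interior B \<subseteq> delta_interior (A \<union> closure (delta_interior A))"
    by (intro delta_interior_mono) (auto simp: B_def)
  then show "closure (delta_interior B) \<subseteq> closure (delta_interior A)"
    using delta_interior_Un_closure by (intro closure_minimal) auto
  show "closure (delta_interior A) \<subseteq> closure (delta_interior B)"
    by (intro closure_mono delta_interior_mono) (auto simp: B_def)
qed

lemma e_closed_e_hull: "e_closed B"
  unfolding e_closed_iff interior_delta_closure_e_hull closure_delta_interior_e_hull
  by (auto simp: B_def)

text \<open>Monotonicity puts the set adjoined to \<open>A\<close> inside the corresponding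
  intersection for any \<open>e_closed\<close> superset \<open>F\<close>, and \<open>F\<close>
  contains the latter.\<close>

lemma e_closure_eq: "e_closure A = B"
proof
  show "e_closure A \<subseteq> B"
    using e_closed_e_hull unfolding e_closure_def by (auto simp: B_def)
  have "B \<subseteq> F" if F: "e_closed F" "A \<subseteq> F" for F
    using F interior_mono[OF delta_closure_mono[OF F(2)]]
      closure_mono[OF delta_interior_mono[OF F(2)]]
    unfolding e_closed_iff B_def by blast
  then show "B \<subseteq> e_closure A"
    unfolding e_closure_def by blast
qed

text \<open>The bound in \<open>e_open\<close> is the same for \<open>A\<close> and
  \<open>B\<close>, and the adjoined intersection already lies inside it.\<close>

lemma e_regular_e_closure:
  assumes "e_open A"
  shows "e_regular (e_closure A)"
proof -
  have "e_open B"
    using assms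
    unfolding e_open_def interior_delta_closure_e_hull closure_delta_interior_e_hull
    by (auto simp: B_def)
  then show ?thesis
    unfolding e_closure_eq e_regular_def using e_closed_e_hull by simp
qed

end

lemma subset_e_closure: "A \<subseteq> e_closure A"
  unfolding e_closure_def by blast

lemma e_closure_e_closed: "e_closed A \<Longrightarrow> e_closure A = A"
  unfolding e_closure_def by blast

text \<open>From left to right the witness \<open>U\<close> is replaced by
  \<open>e_closure U\<close>; conversely an \<open>e_regular\<close> set is its own
  \<open>e_closure\<close>.\<close>

lemma e_theta_interior_iff:
  "x \<in> e_theta_interior A \<longleftrightarrow> (\<exists>U. e_regular U \<and> x \<in> U \<and> U \<subseteq> A)"
proof
  assume "x \<in> e_theta_interior A"
  then show "\<exists>U. e_regular U \<and> x \<in> U \<and> U \<subseteq> A"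
    unfolding e_theta_interior_def using e_regular_e_closure subset_e_closure by blast
next
  assume "\<exists>U. e_regular U \<and> x \<in> U \<and> U \<subseteq> A"
  then show "x \<in> e_theta_interior A"
    unfolding e_theta_interior_def e_regular_def using e_closure_e_closed by blast
qed

theorem theorem3p12:
  fixes f :: "'a::topological_space \<Rightarrow> 'b::topological_space" and x :: 'a
  shows "weakly_eR_continuous_at f x \<longleftrightarrow>
    (\<forall>V. neighborhood (f x) V \<longrightarrow> x \<in> e_theta_interior (f -` closure V))"
proof
  assume f: "weakly_eR_continuous_at f x"
  show "\<forall>V. neighborhood (f x) V \<longrightarrow> x \<in> e_theta_interior (f -` closure V)"
  proof (intro allI impI)
    fix V assume "neighborhood (f x) V"
    \<comment> \<open>Continuity is tested on open sets only, so \<open>V\<close> is first shrunk to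
      an open \<open>W\<close>.\<close>
    then obtain W where W: "open W" "f x \<in> W" "W \<subseteq> V"
      unfolding neighborhood_def by blast
    with f obtain U where "e_regular U" "x \<in> U" "f ` U \<subseteq> closure W"
      unfolding weakly_eR_continuous_at_def by blast
    with closure_mono[OF W(3)] show "x \<in> e_theta_interior (f -` closure V)"
      unfolding e_theta_interior_iff by blast
  qed
next
  assume "\<forall>V. neighborhood (f x) V \<longrightarrow> x \<in> e_theta_interior (f -` closure V)"
  then show "weakly_eR_continuous_at f x"
    unfolding weakly_eR_continuous_at_def neighborhood_def e_theta_interior_iff
      image_subset_iff_subset_vimage by blast
qed

end
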